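(* Let $\mathcal{F}$ be an essential complete simplicial fan in $\mathbb{R}^n$ with $N$ rays, and assume that its type cone $\mathbb{TC}(\mathcal{F})\subset\mathbb{R}^N$ is simplicial. Let $K$ be the $(N-n)\times N$-matrix whose rows are the inner normal vectors of the facets of $\mathbb{TC}(\mathcal{F})$. Then for any positive vector $\ell\in\mathbb{R}_{>0}^{N-n}$, the polytope \[ R_\ell := \{ z\in\mathbb{R}^N \mid Kz=\ell \text{ and } z\ge 0\} \] is a realization of the fan $\mathcal{F}$. Moreover, the polytopes $R_\ell$ for $\ell\in\mathbb{R}_{>0}^{N-n}$ describe all polytopal realizations of $\mathcal{F}$.
   Context: A fan is essential if it contains the cone $\{0\}$, complete if its cones cover $\mathbb{R}^n$, simplicial if every cone is generated by linearly independent vectors. Index the rays of $\mathcal{F}$ by $[N]$, choose a representative vector for each ray, and let $G$ be the $N\times n$ matrix whose rows are these vectors. For $h\in\mathbb{R}^N$ let $P_h:=\{x\in\mathbb{R}^n\mid Gx\le h\}$. A polytope $P\subset\mathbb{R}^n$ is a polytopal realization of $\mathcal{F}$ if $\mathcal{F}$ is its (outer) normal fan; every polytopal realization is $P_h$ for some $h$. For two adjacent maximal cones $\mathbb{R}_{\ge0}\mathbf{R}$, $\mathbb{R}_{\ge0}\mathbf{R}'$ of $\mathcal{F}$ (with $\mathbf{R},\mathbf{R}'$ sets of representative vectors and $\mathbf{R}\smallsetminus\{r\}=\mathbf{R}'\smallsetminus\{r'\}$), let $\sum_{s\in\mathbf{R}\cup\mathbf{R}'}\alpha_{\mathbf{R},\mathbf{R}'}(s)\,s=0$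 be the unique linear dependence with $\alpha_{\mathbf{R},\mathbf{R}'}(r),\alpha_{\mathbf{R},\mathbf{R}'}(r')>0$ and $\alpha_{\mathbf{R},\mathbf{R}'}(r)+\alpha_{\mathbf{R},\mathbf{R}'}(r')=2$. The type cone of $\mathcal{F}$ is the open cone \[ \mathbb{TC}(\mathcal{F}):=\{h\in\mathbb{R}^N\mid \mathcal{F}\text{ is the normal fan of }P_h\}=\Big\{h\in\mathbb{R}^N\;\Big|\;\sum_{s\in\mathbf{R}\cup\mathbf{R}'}\alpha_{\mathbf{R},\mathbf{R}'}(s)\,h_s>0\text{ for all adjacent maximal cones}\Big\}. \] It is invariant under translation by the $n$-dimensional space $G\mathbb{R}^n$. Facets of $\mathbb{TC}(\mathcal{F})$ mean facets of its closure. When nonempty it has at least $N-n$ facets; it is called simplicial when it is nonempty and has precisely $N-n$ facets. A polytope in $\mathbb{R}^N$ is called a realization of $\mathcal{F}$ if it is the image of some $P_h$ with normal fan $\mathcal{F}$ under the injective affine map $\mathbb{R}^n\to\mathbb{R}^N$, $x\mapsto h-Gx$. That the $R_\ell$ describe all polytopal realizations means that for every $h\in\mathbb{TC}(\mathcal{F})$, the image of $P_h$ under $x\mapsto h-Gx$ is $R_\ell$ for some $\ell\in\mathbb{R}_{>0}^{N-n}$. *)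

theory Defs
  imports "HOL-Analysis.Analysis"
begin

text \<open>
  The cone generated by a set of vectors is \<open>convex_cone hull S\<close>; it is closed under addition and
  under scaling by nonnegative reals, and \<open>convex_cone hull {} = {0}\<close>.
\<close>

definition polyhedral_cone :: "'a::euclidean_space set \<Rightarrow> bool" where
  "polyhedral_cone C \<longleftrightarrow> (\<exists>S. finite S \<and> C = convex_cone hull S)"

definition simplicial_cone :: "'a::euclidean_space set \<Rightarrow> bool" where
  "simplicial_cone C \<longleftrightarrow> (\<exists>S. independent S \<and> C = convex_cone hull S)"

text \<open>
  The library relation \<open>face_of\<close> admits the empty set as a face, whereas the faces of a cone (and
  of a polytope, below) are meant to be nonempty. On polyhedra its nonempty faces are exactly the
  polyhedron itself and its intersections with supporting hyperplanes.
\<close>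

definition fan :: "'a::euclidean_space set set \<Rightarrow> bool" where
  "fan \<F> \<longleftrightarrow> finite \<F> \<and>
     (\<forall>C\<in>\<F>. polyhedral_cone C) \<and>
     (\<forall>C\<in>\<F>. \<forall>D. D face_of C \<and> D \<noteq> {} \<longrightarrow> D \<in> \<F>) \<and>
     (\<forall>C\<in>\<F>. \<forall>D\<in>\<F>. C \<inter> D face_of C \<and> C \<inter> D face_of D)"

definition essential_fan :: "'a::euclidean_space set set \<Rightarrow> bool" where
  "essential_fan \<F> \<longleftrightarrow> fan \<F> \<and> {0} \<in> \<F>"

definition complete_fan :: "'a::euclidean_space set set \<Rightarrow> bool" where
  "complete_fan \<F> \<longleftrightarrow> fan \<F> \<and> \<Union>\<F> = UNIV"

definition simplicial_fan :: "'a::euclidean_space set set \<Rightarrow> bool" where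
  "simplicial_fan \<F> \<longleftrightarrow> fan \<F> \<and> (\<forall>C\<in>\<F>. simplicial_cone C)"

definition rays :: "'a::euclidean_space set set \<Rightarrow> 'a set set" where
  "rays \<F> = {C \<in> \<F>. aff_dim C = 1}"

text \<open>
  The rows of \<open>G\<close> are representative vectors of the rays of \<open>\<F>\<close>, one for each ray, so that the
  index type \<open>'m\<close> plays the role of the set of the first \<open>N\<close> positive integers.
\<close>

definition ray_matrix :: "(real^'n) set set \<Rightarrow> real^'n^'m \<Rightarrow> bool" where
  "ray_matrix \<F> G \<longleftrightarrow> bij_betw (\<lambda>i. convex_cone hull {row i G}) UNIV (rays \<F>)"

definition outer_normal_cone :: "'a::euclidean_space set \<Rightarrow> 'a set \<Rightarrow> 'a set" where
  "outer_normal_cone P Q = {c. \<forall>x\<in>Q. \<forall>y\<in>P. c \<bullet> y \<le> c \<bullet> x}"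

definition normal_fan :: "'a::euclidean_space set \<Rightarrow> 'a set set" where
  "normal_fan P = {outer_normal_cone P Q | Q. Q face_of P \<and> Q \<noteq> {}}"

definition polytopal_realization :: "'a::euclidean_space set set \<Rightarrow> 'a set \<Rightarrow> bool" where
  "polytopal_realization \<F> P \<longleftrightarrow> polytope P \<and> normal_fan P = \<F>"

text \<open>The order \<open>\<le>\<close> on \<open>real^'m\<close> is the componentwise one.\<close>

definition P_of :: "real^'n^'m \<Rightarrow> real^'m \<Rightarrow> (real^'n) set" where
  "P_of G h = {x. G *v x \<le> h}"

definition type_cone :: "(real^'n) set set \<Rightarrow> real^'n^'m \<Rightarrow> (real^'m) set" where
  "type_cone \<F> G = {h. polytopal_realization \<F> (P_of G h)}"

definition type_cone_facets :: "(real^'n) set set \<Rightarrow> real^'n^'m \<Rightarrow> (real^'m) set set" where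
  "type_cone_facets \<F> G = {\<Phi>. \<Phi> facet_of closure (type_cone \<F> G)}"

text \<open>
  Here \<open>CARD('m) = N\<close> and \<open>CARD('n) = n\<close>; the last conjunct says that there are precisely
  \<open>N - n\<close> facets without using truncated subtraction.
\<close>

definition simplicial_type_cone :: "(real^'n) set set \<Rightarrow> real^'n^'m \<Rightarrow> bool" where
  "simplicial_type_cone \<F> G \<longleftrightarrow> type_cone \<F> G \<noteq> {} \<and>
     finite (type_cone_facets \<F> G) \<and>
     card (type_cone_facets \<F> G) + CARD('n) = CARD('m)"

text \<open>
  All supporting hyperplanes of a cone pass through the origin, hence no affine offset is needed.
\<close>

definition inner_normal :: "'a::euclidean_space set \<Rightarrow> 'a set \<Rightarrow> 'a \<Rightarrow> bool" where
  "inner_normal C \<Phi> a \<longleftrightarrow> a \<noteq> 0 \<and> (\<forall>h\<in>C. a \<bullet> h \<ge> 0) \<and> \<Phi> = {h \<in> C. a \<bullet> h = 0}"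

definition facet_normal_matrix ::
    "(real^'n) set set \<Rightarrow> real^'n^'m \<Rightarrow> real^'m^'k \<Rightarrow> bool" where
  "facet_normal_matrix \<F> G K \<longleftrightarrow>
     (\<exists>\<phi>. bij_betw \<phi> UNIV (type_cone_facets \<F> G) \<and>
          (\<forall>i. inner_normal (closure (type_cone \<F> G)) (\<phi> i) (row i K)))"

definition R_of :: "real^'m^'k \<Rightarrow> real^'k \<Rightarrow> (real^'m) set" where
  "R_of K l = {z. K *v z = l \<and> 0 \<le> z}"

definition slack_image :: "real^'n^'m \<Rightarrow> real^'m \<Rightarrow> (real^'m) set" where
  "slack_image G h = (\<lambda>x. h - G *v x) ` P_of G h"

definition slack_realization ::
    "(real^'n) set set \<Rightarrow> real^'n^'m \<Rightarrow> (real^'m) set \<Rightarrow> bool" where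
  "slack_realization \<F> G Q \<longleftrightarrow> polytope Q \<and>
     (\<exists>h. polytopal_realization \<F> (P_of G h) \<and> Q = slack_image G h)"

end

theory Submission
  imports Defs
begin

text \<open>
  The whole argument takes place in the space \<open>\<real>\<^sup>N\<close> of right-hand sides. Once the type cone is known to be
  the open polyhedral cone \<open>{h. K h > 0}\<close> and the kernel of \<open>K\<close> to be the space \<open>G \<real>\<^sup>n\<close> of translations,
  the statement becomes linear algebra: for any \<open>h\<close>, the points \<open>z \<ge> 0\<close> with \<open>K z = K h\<close> are exactly
  those of the form \<open>z = h - G x\<close> with \<open>G x \<le> h\<close>, so that \<open>R_of K (K h) = slack_image G h\<close>. Every
  \<open>h\<close> in the type cone gives a positive vector \<open>l = K h\<close>. Conversely \<open>K\<close> is onto, because its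
  kernel has dimension at most \<open>n\<close> and it has \<open>N - n\<close> rows; hence every positive \<open>l\<close> is some \<open>K h\<close>,
  and then \<open>h\<close> lies in the type cone.

  That the type cone is an open polyhedral cone is shown with a redundant but convenient system of
  inequalities. A full-dimensional cone \<open>D\<close> of the fan is spanned by \<open>n\<close> linearly independent rows
  of \<open>G\<close>, and making those inequalities tight determines a point \<open>v\<close>, which depends linearly on \<open>h\<close>.
  The fan is the normal fan of \<open>P_of G h\<close> if and only if each such \<open>v\<close> satisfies all remaining
  inequalities strictly (\<open>type_cone_eq\<close>). If it does, completeness of the fan makes every
  linear functional a positive combination of the generators of some cone \<open>E\<close>, so that this
  functional is maximized precisely where the inequalities of \<open>E\<close> are tight; the faces of the
  polytope therefore correspond to the cones of the fan. For the converse, linear programming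
  duality shows that no inequality of a realization is slack
  everywhere (\<open>ray_attains_bound\<close>), which forces \<open>v\<close> to be the vertex with normal cone \<open>D\<close>.
  The linear forms of this system all vanish on \<open>z\<close> exactly when \<open>z\<close> is in \<open>G \<real>\<^sup>n\<close>, so they identify the
  lineality space of the type cone and hence the kernel of \<open>K\<close>.

  The passage from this system to the facet normals is a statement about full-dimensional
  polyhedra (\<open>facet_normals_describe_interior\<close>): a segment leaving the polyhedron crosses a facet,
  where one of the normals vanishes.
\<close>

section \<open>Finitely generated convex cones and their faces\<close>

lemma convex_cone_hull_indexed:
  fixes g :: "'i \<Rightarrow> 'a::real_vector"
  assumes "finite I"
  shows "convex_cone hull (g ` I) = {\<Sum>i\<in>I. c i *\<^sub>R g i | c. \<forall>i\<in>I. (0::real) \<le> c i}"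
    (is "_ = ?R")
proof (rule hull_unique)
  show "g ` I \<subseteq> ?R"
  proof clarify
    fix i assume "i \<in> I"
    then have "g i = (\<Sum>k\<in>I. (if k = i then 1 else 0) *\<^sub>R g k)"
      using assms by (simp add: if_distrib [of "\<lambda>r. r *\<^sub>R _"] cong: if_cong)
    then show "\<exists>c. g i = (\<Sum>k\<in>I. c k *\<^sub>R g k) \<and> (\<forall>k\<in>I. 0 \<le> c k)"
      by (intro exI [of _ "\<lambda>k. if k = i then 1 else 0"]) auto
  qed
  show "convex_cone ?R"
    unfolding convex_cone_iff
  proof (intro conjI ballI allI impI)
    show "0 \<in> ?R"
      by (auto intro: exI [of _ "\<lambda>_. 0"])
  next
    fix x y assume "x \<in> ?R" "y \<in> ?R"
    then obtain c d where "x = (\<Sum>i\<in>I. c i *\<^sub>R g i)" "\<forall>i\<in>I. 0 \<le> c i"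
      "y = (\<Sum>i\<in>I. d i *\<^sub>R g i)" "\<forall>i\<in>I. 0 \<le> d i" by blast
    then show "x + y \<in> ?R"
      by (auto intro!: exI [of _ "\<lambda>i. c i + d i"] simp: scaleR_add_left sum.distrib)
  next
    fix x and r :: real assume "x \<in> ?R" "0 \<le> r"
    then obtain c where "x = (\<Sum>i\<in>I. c i *\<^sub>R g i)" "\<forall>i\<in>I. 0 \<le> c i" by blast
    with \<open>0 \<le> r\<close> show "r *\<^sub>R x \<in> ?R"
      by (auto intro!: exI [of _ "\<lambda>i. r * c i"] simp: scaleR_sum_right)
  qed
next
  fix T assume T: "g ` I \<subseteq> T" "convex_cone T"
  have "(\<Sum>i\<in>J. c i *\<^sub>R g i) \<in> T" if "finite J" "J \<subseteq> I" "\<forall>i\<in>I. 0 \<le> c i" for J and c :: "'i \<Rightarrow> real"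
    using that
  proof (induction J rule: finite_induct)
    case empty
    then show ?case using T(2) by (simp add: convex_cone_contains_0)
  next
    case (insert i J)
    then have "c i *\<^sub>R g i \<in> T"
      using T by (intro convex_cone_scaleR) auto
    with insert T show ?case by (simp add: convex_cone_add)
  qed
  then show "?R \<subseteq> T" using assms by auto
qed

lemma sum_in_convex_cone_hull:
  fixes g :: "'i::finite \<Rightarrow> 'a::real_vector"
  assumes "\<And>i. i \<in> I \<Longrightarrow> 0 \<le> c i"
  shows "(\<Sum>i\<in>I. c i *\<^sub>R g i) \<in> convex_cone hull (g ` I)"
  using assms by (subst convex_cone_hull_indexed) auto

lemma convex_cone_hull_singleton: "convex_cone hull {v} = {t *\<^sub>R v | t. (0::real) \<le> t}"
proof -
  have "\<exists>c. t *\<^sub>R v = c () *\<^sub>R v \<and> 0 \<le> c ()" if "0 \<le> t" for t :: real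
    using that by (intro exI [of _ "\<lambda>_. t"]) simp
  then show ?thesis
    using convex_cone_hull_indexed [of "{()}" "\<lambda>_. v"] by auto
qed

lemma aff_dim_convex_cone_hull_singleton:
  fixes v :: "'a::euclidean_space"
  assumes "v \<noteq> 0"
  shows "aff_dim (convex_cone hull {v}) = 1"
proof -
  have "convex_cone hull {v} \<subseteq> span {v}"
    by (auto simp: convex_cone_hull_singleton span_singleton)
  then have "span (convex_cone hull {v}) = span {v}"
    by (intro antisym span_minimal span_mono) (auto simp: hull_inc)
  then have "dim (convex_cone hull {v}) = 1"
    using assms by (metis dim_span dim_singleton)
  then show ?thesis
    by (simp add: aff_dim_zero convex_cone_hull_contains_0 hull_inc)
qed

text \<open>
  The midpoint of \<open>2 x\<close> and \<open>2 y\<close> is \<open>x + y\<close>, so a face containing the sum contains both doubled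
  summands, and faces of cones are cones.
\<close>

lemma face_summand:
  fixes C :: "'a::euclidean_space set"
  assumes C: "convex_cone C" and T: "T face_of C" and "x \<in> C" "y \<in> C" "x + y \<in> T"
  shows "x \<in> T"
proof -
  have two: "2 *\<^sub>R x \<in> C" "2 *\<^sub>R y \<in> C"
    using assms by (auto intro: convex_cone_scaleR)
  have "2 *\<^sub>R x \<in> T"
  proof (cases "x = y")
    case True
    with assms show ?thesis by (simp add: scaleR_2)
  next
    case False
    have "x + y \<in> open_segment (2 *\<^sub>R x) (2 *\<^sub>R y)"
      using False unfolding in_segment
      by (auto intro!: exI [of _ "1/2"])
    with T two \<open>x + y \<in> T\<close> show ?thesis
      using face_ofD by blast
  qed
  moreover have "conic T"
    using C face_of_conic [OF _ T] by (simp add: convex_cone_def)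
  ultimately show ?thesis
    using conicD [of T "2 *\<^sub>R x" "1/2"] by simp
qed

lemma face_summand_sum:
  fixes C :: "'a::euclidean_space set"
  assumes C: "convex_cone C" and T: "T face_of C" and "finite I"
    and "\<And>i. i \<in> I \<Longrightarrow> f i \<in> C" and "sum f I \<in> T" and "i \<in> I"
  shows "f i \<in> T"
proof -
  have "sum f (I - {i}) \<in> C"
  proof -
    have "sum f J \<in> C" if "finite J" "J \<subseteq> I" for J
      using that
    proof (induction J rule: finite_induct)
      case empty
      then show ?case using C by (simp add: convex_cone_contains_0)
    next
      case (insert j J)
      then show ?case using C assms(4) by (simp add: convex_cone_add)
    qed
    then show ?thesis using \<open>finite I\<close> by simp
  qed
  moreover have "sum f I = f i + sum f (I - {i})"
    using assms by (simp add: sum.remove)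
  ultimately show ?thesis
    using face_summand [OF C T, of "f i" "sum f (I - {i})"] assms(4,5,6) by metis
qed

text \<open>
  Linear independence enters the proof only through this dual form, the solvability of
  \<open>s \<bullet> x = t s\<close>. It yields the supporting functionals of the faces of a simplicial cone
  and the candidate vertices of \<open>P_of G h\<close>.
\<close>

lemma independent_inner_prescribed:
  fixes S :: "'a::euclidean_space set"
  assumes "independent S"
  shows "\<exists>x. \<forall>s\<in>S. s \<bullet> x = t s"
proof -
  obtain f :: "'a \<Rightarrow> real" where f: "linear f" "\<forall>s\<in>S. f s = t s"
    using linear_independent_extend [OF assms] by blast
  then have "s \<bullet> adjoint f 1 = f s" for s
    using adjoint_works [OF f(1), of s 1] by (simp add: inner_commute)
  with f show ?thesis by metis
qed

text \<open>
  A nonnegative combination on which \<open>a\<close> vanishes can use only generators on which \<open>a\<close> vanishes.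
\<close>

lemma convex_cone_hull_face_of_functional:
  fixes a :: "'a::euclidean_space" and g :: "'i \<Rightarrow> 'a"
  assumes "finite I" "J \<subseteq> I" and zero: "\<And>i. i \<in> J \<Longrightarrow> a \<bullet> g i = 0"
    and pos: "\<And>i. i \<in> I - J \<Longrightarrow> a \<bullet> g i > 0"
  shows "convex_cone hull (g ` J) face_of convex_cone hull (g ` I)"
proof -
  let ?C = "convex_cone hull (g ` I)"
  have finJ: "finite J" using assms finite_subset by blast
  have a_nonneg: "a \<bullet> g i \<ge> 0" if "i \<in> I" for i
    using zero pos that by (cases "i \<in> J") (auto simp: less_imp_le)
  have "convex_cone hull (g ` J) = ?C \<inter> {x. a \<bullet> x = 0}"
  proof (intro antisym subsetI IntI)
    fix x assume x: "x \<in> convex_cone hull (g ` J)"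
    then show "x \<in> ?C" using hull_mono [of "g ` J" "g ` I"] \<open>J \<subseteq> I\<close> by blast
    show "x \<in> {x. a \<bullet> x = 0}"
      using x zero by (auto simp: convex_cone_hull_indexed [OF finJ] inner_sum_right)
  next
    fix x assume x: "x \<in> ?C \<inter> {x. a \<bullet> x = 0}"
    then obtain c where c: "x = (\<Sum>i\<in>I. c i *\<^sub>R g i)" "\<forall>i\<in>I. 0 \<le> c i"
      by (auto simp: convex_cone_hull_indexed [OF \<open>finite I\<close>])
    have "(\<Sum>i\<in>I. c i * (a \<bullet> g i)) = 0"
      using x c by (auto simp: inner_sum_right)
    then have "\<forall>i\<in>I. c i * (a \<bullet> g i) = 0"
      using c a_nonneg by (subst (asm) sum_nonneg_eq_0_iff) (auto simp: \<open>finite I\<close>)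
    then have "c i = 0" if "i \<in> I - J" for i
      using pos [OF that] that by auto
    then have "x = (\<Sum>i\<in>J. c i *\<^sub>R g i)"
      unfolding c(1) using assms by (intro sum.mono_neutral_right) auto
    then show "x \<in> convex_cone hull (g ` J)"
      using c \<open>J \<subseteq> I\<close> by (auto simp: convex_cone_hull_indexed [OF finJ])
  qed
  moreover have "?C \<inter> {x. a \<bullet> x = 0} face_of ?C"
  proof (rule face_of_Int_supporting_hyperplane_ge)
    show "a \<bullet> x \<ge> 0" if "x \<in> ?C" for x
      using that a_nonneg by (auto simp: convex_cone_hull_indexed [OF \<open>finite I\<close>] inner_sum_right intro!: sum_nonneg)
  qed (rule convex_convex_cone_hull)
  ultimately show ?thesis by simp
qed

lemma convex_cone_hull_face_of_independent:
  fixes S :: "'a::euclidean_space set"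
  assumes "independent S" "T \<subseteq> S"
  shows "convex_cone hull T face_of convex_cone hull S"
proof -
  obtain a where a: "\<forall>s\<in>S. s \<bullet> a = (if s \<in> T then 0 else 1)"
    using independent_inner_prescribed [OF assms(1), of "\<lambda>s. if s \<in> T then 0 else 1"] by blast
  have "convex_cone hull ((\<lambda>s. s) ` T) face_of convex_cone hull ((\<lambda>s. s) ` S)"
    using a assms independent_imp_finite
    by (intro convex_cone_hull_face_of_functional [where a = a]) (auto simp: inner_commute)
  then show ?thesis by simp
qed

section \<open>Optimality over systems of inequalities\<close>

lemma small_step_preserves_strict:
  fixes a b c :: "'i \<Rightarrow> real"
  assumes "finite J" "\<And>j. j \<in> J \<Longrightarrow> a j < b j"
  shows "\<exists>e>0. \<forall>j\<in>J. a j + e * c j < b j"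
proof -
  have "\<forall>\<^sub>F e in at_right 0. a j + e * c j < b j" if "j \<in> J" for j
  proof (rule order_tendstoD(2))
    show "((\<lambda>e. a j + e * c j) \<longlongrightarrow> a j + 0 * c j) (at_right 0)"
      by (intro tendsto_intros)
  qed (use assms that in auto)
  then have "\<forall>\<^sub>F e in at_right 0. \<forall>j\<in>J. a j + e * c j < b j"
    using \<open>finite J\<close> by (simp add: eventually_ball_finite)
  moreover have "\<forall>\<^sub>F e in at_right (0::real). 0 < e"
    by (simp add: eventually_at_right_less)
  ultimately have "\<forall>\<^sub>F e in at_right 0. 0 < e \<and> (\<forall>j\<in>J. a j + e * c j < b j)"
    by eventually_elim auto
  then obtain e where "0 < e \<and> (\<forall>j\<in>J. a j + e * c j < b j)"
    using eventually_happens' [OF trivial_limit_at_right_real] by blast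
  then show ?thesis by blast
qed

text \<open>
  Linear programming duality. If \<open>c\<close> were outside the cone of the tight rows, a separating
  hyperplane would give a direction along which no tight constraint increases but \<open>c\<close> does. A small
  step in this direction respects the other constraints, so \<open>x\<close> would not be optimal.
\<close>

lemma optimal_imp_in_tight_cone:
  fixes g :: "'i::finite \<Rightarrow> 'a::euclidean_space"
  assumes x: "\<And>i. g i \<bullet> x \<le> h i"
    and opt: "\<And>y. (\<And>i. g i \<bullet> y \<le> h i) \<Longrightarrow> c \<bullet> y \<le> c \<bullet> x"
  shows "c \<in> convex_cone hull (g ` {i. g i \<bullet> x = h i})"
proof (rule ccontr)
  let ?K = "convex_cone hull (g ` {i. g i \<bullet> x = h i})"
  assume "c \<notin> ?K"
  then obtain a b where ab: "a \<bullet> c < b" "\<forall>z\<in>?K. b < a \<bullet> z"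
    using separating_hyperplane_closed_point [OF convex_convex_cone_hull closed_convex_cone_hull, of _ c]
    by (meson finite finite_imageI)
  have "b < 0" using ab(2) convex_cone_hull_contains_0 by force
  \<comment> \<open>A point of the cone with \<open>a \<bullet> z < 0\<close> could be scaled until it meets the separating hyperplane.\<close>
  have a_nonneg: "0 \<le> a \<bullet> z" if "z \<in> ?K" for z
  proof (rule ccontr)
    assume neg: "\<not> 0 \<le> a \<bullet> z"
    with \<open>b < 0\<close> have "0 \<le> b / (a \<bullet> z)" by (simp add: divide_nonpos_neg)
    then have "(b / (a \<bullet> z)) *\<^sub>R z \<in> ?K" using that by (rule convex_cone_hull_mul [rotated])
    then have "b < a \<bullet> ((b / (a \<bullet> z)) *\<^sub>R z)" using ab(2) by blast
    with neg show False by simp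
  qed
  have "\<exists>e>0. \<forall>i\<in>{i. g i \<bullet> x < h i}. g i \<bullet> x + e * (- (g i \<bullet> a)) < h i"
    by (rule small_step_preserves_strict) auto
  then obtain e where e: "0 < e" "\<And>i. g i \<bullet> x < h i \<Longrightarrow> g i \<bullet> x + e * (- (g i \<bullet> a)) < h i"
    by blast
  have "g i \<bullet> (x - e *\<^sub>R a) \<le> h i" for i
  proof (cases "g i \<bullet> x = h i")
    case True
    then have "0 \<le> a \<bullet> g i" by (intro a_nonneg hull_inc) auto
    with True e(1) show ?thesis by (simp add: inner_diff_right inner_commute)
  next
    case False
    with x [of i] e(2) [of i] show ?thesis by (simp add: inner_diff_right)
  qed
  then have "c \<bullet> (x - e *\<^sub>R a) \<le> c \<bullet> x" by (rule opt)
  then have "0 \<le> a \<bullet> c" using e(1) by (simp add: inner_diff_right inner_commute zero_le_mult_iff)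
  with ab(1) \<open>b < 0\<close> show False by simp
qed

lemma bounded_if_bounded_above_in_directions:
  fixes P :: "'a::euclidean_space set"
  assumes "\<And>c. \<exists>M. \<forall>x\<in>P. c \<bullet> x \<le> M"
  shows "bounded P"
proof -
  obtain M where M: "\<And>c x. x \<in> P \<Longrightarrow> c \<bullet> x \<le> M c" using assms by metis
  have "norm x \<le> (\<Sum>b\<in>Basis. \<bar>M b\<bar> + \<bar>M (- b)\<bar>)" if "x \<in> P" for x
  proof -
    have "\<bar>x \<bullet> b\<bar> \<le> \<bar>M b\<bar> + \<bar>M (- b)\<bar>" for b
      using M [OF that, of b] M [OF that, of "- b"] by (simp add: inner_commute)
    then show ?thesis
      by (intro order_trans [OF norm_le_l1]) (rule sum_mono)
  qed
  then show ?thesis by (auto simp: bounded_iff)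
qed

lemma mult_vec_nth_eq_inner_row: "(A *v x) $ i = row i A \<bullet> x"
  for A :: "real^'n^'m"
proof -
  have "row i A = A $ i" by (simp add: row_def)
  then show ?thesis by (simp add: matrix_vector_mul_component)
qed

lemma mem_P_of: "x \<in> P_of G h \<longleftrightarrow> (\<forall>i. row i G \<bullet> x \<le> h $ i)"
  by (simp add: P_of_def less_eq_vec_def mult_vec_nth_eq_inner_row)

lemma polyhedron_P_of: "polyhedron (P_of G h)"
proof -
  have "P_of G h = \<Inter>(range (\<lambda>i. {x. row i G \<bullet> x \<le> h $ i}))"
    by (auto simp: mem_P_of)
  moreover have "polyhedron (\<Inter>(range (\<lambda>i. {x. row i G \<bullet> x \<le> h $ i})))"
    by (intro polyhedron_Inter) (auto simp: polyhedron_halfspace_le)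
  ultimately show ?thesis by simp
qed

section \<open>Combinatorics of complete simplicial fans\<close>

locale simplicial_complete_fan =
  fixes \<F> :: "(real^'n) set set" and G :: "real^'n^'m"
  assumes fan: "fan \<F>" and complete: "\<Union>\<F> = UNIV"
    and simplicial: "\<And>C. C \<in> \<F> \<Longrightarrow> simplicial_cone C"
    and ray_matrix: "ray_matrix \<F> G"
begin

abbreviation g :: "'m \<Rightarrow> real^'n" where "g i \<equiv> row i G"

text \<open>
  The cones of the fan are encoded by the index sets of the rays that they contain, so that
  generators, tight inequalities and faces can all be compared as sets of indices.
\<close>

definition gens :: "(real^'n) set \<Rightarrow> 'm set" where "gens C = {i. g i \<in> C}"

lemma finite_fan: "finite \<F>"
  using fan by (simp add: fan_def)

lemma face_in_fan: "C \<in> \<F> \<Longrightarrow> D face_of C \<Longrightarrow> D \<noteq> {} \<Longrightarrow> D \<in> \<F>"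
  using fan by (auto simp: fan_def)

lemma Int_face: "C \<in> \<F> \<Longrightarrow> D \<in> \<F> \<Longrightarrow> C \<inter> D face_of C"
  using fan by (auto simp: fan_def)

lemma convex_cone_fan: "C \<in> \<F> \<Longrightarrow> convex_cone C"
  using simplicial convex_cone_convex_cone_hull by (auto simp: simplicial_cone_def)

lemma ray_in_fan: "convex_cone hull {g i} \<in> \<F>"
  and aff_dim_ray: "aff_dim (convex_cone hull {g i}) = 1"
  using ray_matrix by (auto simp: ray_matrix_def bij_betw_def rays_def)

lemma ray_nonzero: "g i \<noteq> 0"
proof
  assume "g i = 0"
  then have "convex_cone hull {g i} = {0}"
    by (auto simp: convex_cone_hull_singleton)
  then show False using aff_dim_ray [of i] by simp
qed

lemma ray_unique:
  assumes "g i \<in> convex_cone hull {g j}"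
  shows "i = j"
proof -
  obtain t where t: "g i = t *\<^sub>R g j" "0 \<le> t"
    using assms by (auto simp: convex_cone_hull_singleton)
  with ray_nonzero [of i] have "0 < t" by (cases "t = 0") auto
  then have "g j = (1/t) *\<^sub>R g i" using t by simp
  then have "g j \<in> convex_cone hull {g i}"
    unfolding convex_cone_hull_singleton using \<open>0 < t\<close> by (auto intro!: exI [of _ "1/t"])
  with assms have "convex_cone hull {g i} = convex_cone hull {g j}"
    by (intro antisym hull_minimal) (auto simp: convex_cone_convex_cone_hull)
  then show ?thesis
    using ray_matrix by (auto simp: ray_matrix_def bij_betw_def inj_on_def)
qed

lemma convex_cone_hull_gens_subset:
  assumes "C \<in> \<F>" "J \<subseteq> gens C"
  shows "convex_cone hull (g ` J) \<subseteq> C"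
  using assms convex_cone_fan by (intro hull_minimal) (auto simp: gens_def)

text \<open>
  The linearly independent generators provided by simpliciality are, up to positive factors, the
  representatives of the rays contained in the cone: a single generator spans a face, hence a ray of
  the fan, and conversely a ray in the cone is a face of it, so it contains any generator that occurs
  in its representative.
\<close>

lemma simplicial_generators:
  assumes C: "C \<in> \<F>"
  obtains S where "independent S" "C = convex_cone hull S"
    "\<And>s. s \<in> S \<Longrightarrow> \<exists>i\<in>gens C. \<exists>r>0. s = r *\<^sub>R g i"
    "\<And>i. i \<in> gens C \<Longrightarrow> \<exists>s\<in>S. \<exists>r>0. s = r *\<^sub>R g i"
proof -
  obtain S where S: "independent S" "C = convex_cone hull S"
    using simplicial [OF C] by (auto simp: simplicial_cone_def)
  have finS: "finite S" using S(1) independent_imp_finite by blast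
  have 1: "\<exists>i\<in>gens C. \<exists>r>0. s = r *\<^sub>R g i" if s: "s \<in> S" for s
  proof -
    have "s \<noteq> 0" using S(1) s dependent_zero by blast
    have "convex_cone hull {s} face_of C"
      using S s by (simp add: convex_cone_hull_face_of_independent)
    then have "convex_cone hull {s} \<in> rays \<F>"
      using face_in_fan [OF C] aff_dim_convex_cone_hull_singleton [OF \<open>s \<noteq> 0\<close>]
        convex_cone_hull_nonempty [of "{s}"]
      by (auto simp: rays_def)
    then obtain i where i: "convex_cone hull {s} = convex_cone hull {g i}"
      using ray_matrix by (auto simp: ray_matrix_def bij_betw_def)
    then have "s \<in> convex_cone hull {g i}" "g i \<in> convex_cone hull {s}"
      by (metis hull_inc singletonI)+
    then obtain r where r: "s = r *\<^sub>R g i" "0 \<le> r"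
      by (auto simp: convex_cone_hull_singleton)
    with \<open>s \<noteq> 0\<close> have "0 < r" by (cases "r = 0") auto
    moreover have "g i \<in> C"
      using \<open>g i \<in> convex_cone hull {s}\<close> S s hull_mono [of "{s}" S convex_cone] by auto
    ultimately show ?thesis using r by (auto simp: gens_def)
  qed
  have 2: "\<exists>s\<in>S. \<exists>r>0. s = r *\<^sub>R g i" if i: "i \<in> gens C" for i
  proof -
    have "g i \<in> C" using i by (simp add: gens_def)
    then obtain c where c: "g i = (\<Sum>s\<in>S. c s *\<^sub>R s)" "\<forall>s\<in>S. 0 \<le> c s"
      using S(2) convex_cone_hull_indexed [OF finS, of "\<lambda>s. s"] by auto
    have "convex_cone hull {g i} \<subseteq> C"
      using convex_cone_hull_gens_subset [OF C, of "{i}"] i by auto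
    then have face: "convex_cone hull {g i} face_of C"
      using Int_face [OF C ray_in_fan, of i] by (simp add: Int_absorb1)
    obtain s where s: "s \<in> S" "c s \<noteq> 0"
      using c(1) ray_nonzero [of i] by (metis (no_types, lifting) scaleR_zero_left sum.neutral)
    \<comment> \<open>The ray is a face of the cone, so it contains each summand of \<open>g i\<close>.\<close>
    have "c s *\<^sub>R s \<in> convex_cone hull {g i}"
    proof (rule face_summand_sum [where f = "\<lambda>s. c s *\<^sub>R s" and I = S, OF _ face finS])
      show "convex_cone C" by (rule convex_cone_fan [OF C])
      show "c u *\<^sub>R u \<in> C" if "u \<in> S" for u
        using that c S by (simp add: convex_cone_hull_mul hull_inc)
      show "(\<Sum>s\<in>S. c s *\<^sub>R s) \<in> convex_cone hull {g i}"
        using c(1) by (metis hull_inc singletonI)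
    qed (rule s)
    then obtain t where t: "c s *\<^sub>R s = t *\<^sub>R g i" "0 \<le> t"
      by (auto simp: convex_cone_hull_singleton)
    have "s \<noteq> 0" using S(1) s dependent_zero by blast
    then have "t \<noteq> 0" using t s by auto
    have "s = (t / c s) *\<^sub>R g i"
      using t s by (metis divide_inverse_commute scaleR_scaleR left_inverse scaleR_one)
    moreover have "0 < t / c s" using s c t \<open>t \<noteq> 0\<close> by (simp add: less_le)
    ultimately show ?thesis using s by blast
  qed
  show ?thesis by (rule that [OF S 1 2])
qed

lemma fan_cone_eq:
  assumes C: "C \<in> \<F>"
  shows "C = convex_cone hull (g ` gens C)"
proof
  obtain S where S: "C = convex_cone hull S" "\<And>s. s \<in> S \<Longrightarrow> \<exists>i\<in>gens C. \<exists>r>0. s = r *\<^sub>R g i"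
    using simplicial_generators [OF C] by metis
  have "convex_cone hull S \<subseteq> convex_cone hull (g ` gens C)"
  proof (rule hull_minimal)
    show "S \<subseteq> convex_cone hull (g ` gens C)"
      using S(2) by (fastforce simp: less_imp_le intro: convex_cone_hull_mul hull_inc)
  qed (rule convex_cone_convex_cone_hull)
  with S show "C \<subseteq> convex_cone hull (g ` gens C)" by simp
qed (use C convex_cone_hull_gens_subset in auto)

text \<open>
  The rows of a cone are positive multiples of distinct members of an independent set. Distinctness
  is needed to prescribe the values separately and holds because different indices give different rays.
\<close>

lemma prescribed_on_gens:
  assumes C: "C \<in> \<F>"
  shows "\<exists>x. \<forall>i\<in>gens C. g i \<bullet> x = t i"
proof -
  obtain S where S: "independent S" "\<And>i. i \<in> gens C \<Longrightarrow> \<exists>s\<in>S. \<exists>r>0. s = r *\<^sub>R g i"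
    using simplicial_generators [OF C] by metis
  then obtain \<sigma> r where sr: "\<And>i. i \<in> gens C \<Longrightarrow> \<sigma> i \<in> S \<and> r i > 0 \<and> \<sigma> i = r i *\<^sub>R g i"
    by metis
  have inj: "i = j" if "i \<in> gens C" "j \<in> gens C" "\<sigma> i = \<sigma> j" for i j
  proof (rule ray_unique)
    have "r i *\<^sub>R g i = r j *\<^sub>R g j" using sr that by metis
    then have "g i = (r j / r i) *\<^sub>R g j"
      using sr [OF that(1)] by (metis divide_inverse_commute scaleR_scaleR left_inverse scaleR_one less_irrefl)
    moreover have "0 \<le> r j / r i" using sr that by (simp add: less_imp_le)
    ultimately show "g i \<in> convex_cone hull {g j}"
      by (auto simp: convex_cone_hull_singleton)
  qed
  obtain x where x: "\<forall>s\<in>S. s \<bullet> x = r (inv_into (gens C) \<sigma> s) * t (inv_into (gens C) \<sigma> s)"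
    using independent_inner_prescribed [OF S(1), of "\<lambda>s. r (inv_into (gens C) \<sigma> s) * t (inv_into (gens C) \<sigma> s)"] by blast
  have "g i \<bullet> x = t i" if i: "i \<in> gens C" for i
  proof -
    have "inv_into (gens C) \<sigma> (\<sigma> i) = i"
      using inj i by (intro inv_into_f_f) (auto simp: inj_on_def)
    then have "\<sigma> i \<bullet> x = r i * t i" using x sr i by metis
    then have "r i * (g i \<bullet> x) = r i * t i" using sr [OF i] by simp
    then show ?thesis using sr [OF i] by simp
  qed
  then show ?thesis by blast
qed

text \<open>
  A vector that is \<open>0\<close> on the chosen generators and \<open>1\<close> on the others exposes the subcone as a face,
  and also shows that the subcone contains no further ray.
\<close>

lemma gens_subcone:
  assumes C: "C \<in> \<F>" and J: "J \<subseteq> gens C"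
  shows "convex_cone hull (g ` J) \<in> \<F>" and "gens (convex_cone hull (g ` J)) = J"
proof -
  obtain a where a: "\<forall>i\<in>gens C. g i \<bullet> a = (if i \<in> J then 0 else 1)"
    using prescribed_on_gens [OF C, of "\<lambda>i. if i \<in> J then 0 else 1"] by blast
  have "convex_cone hull (g ` J) face_of convex_cone hull (g ` gens C)"
    using a J by (intro convex_cone_hull_face_of_functional [where a = a]) (auto simp: inner_commute)
  then show "convex_cone hull (g ` J) \<in> \<F>"
    using face_in_fan [OF C] fan_cone_eq [OF C] convex_cone_hull_nonempty by metis
  show "gens (convex_cone hull (g ` J)) = J"
  proof
    show "J \<subseteq> gens (convex_cone hull (g ` J))"
      by (auto simp: gens_def intro: hull_inc)
    show "gens (convex_cone hull (g ` J)) \<subseteq> J"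
    proof
      fix j assume j: "j \<in> gens (convex_cone hull (g ` J))"
      then obtain c where "g j = (\<Sum>i\<in>J. c i *\<^sub>R g i)"
        by (auto simp: gens_def convex_cone_hull_indexed)
      then have "g j \<bullet> a = 0"
        using a J by (auto simp: inner_sum_left intro!: sum.neutral)
      moreover have "j \<in> gens C"
        using j convex_cone_hull_gens_subset [OF C J] by (auto simp: gens_def)
      ultimately show "j \<in> J" using a by (auto split: if_splits)
    qed
  qed
qed

text \<open>
  Dropping the generators with coefficient zero leaves a face of the cone that contains \<open>x\<close> in its
  relative interior. Strict positivity of the coefficients is what later makes maximizing \<open>x\<close>
  over \<open>P_of G h\<close> equivalent to making all inequalities of that face tight.
\<close>

lemma positive_carrier:
  obtains D c where "D \<in> \<F>" "x = (\<Sum>i\<in>gens D. c i *\<^sub>R g i)" "\<And>i. i \<in> gens D \<Longrightarrow> (0::real) < c i"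
proof -
  obtain C where C: "C \<in> \<F>" "x \<in> C" using complete by blast
  then have "x \<in> convex_cone hull (g ` gens C)" using fan_cone_eq by blast
  then obtain c where c: "x = (\<Sum>i\<in>gens C. c i *\<^sub>R g i)" "\<forall>i\<in>gens C. 0 \<le> c i"
    by (auto simp: convex_cone_hull_indexed)
  define J where "J = {i \<in> gens C. 0 < c i}"
  have J: "J \<subseteq> gens C" by (auto simp: J_def)
  have x: "x = (\<Sum>i\<in>J. c i *\<^sub>R g i)"
    unfolding c(1) using c(2) by (intro sum.mono_neutral_right) (auto simp: J_def less_le)
  show ?thesis
  proof (rule that)
    show "convex_cone hull (g ` J) \<in> \<F>" by (rule gens_subcone(1) [OF C(1) J])
    show "x = (\<Sum>i\<in>gens (convex_cone hull (g ` J)). c i *\<^sub>R g i)"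
      unfolding gens_subcone(2) [OF C(1) J] by (rule x)
    show "0 < c i" if "i \<in> gens (convex_cone hull (g ` J))" for i
      using that unfolding gens_subcone(2) [OF C(1) J] by (simp add: J_def)
  qed
qed

definition maximal_cones :: "(real^'n) set set" where
  "maximal_cones = {D \<in> \<F>. interior D \<noteq> {}}"

lemma maximal_in_fan: "D \<in> maximal_cones \<Longrightarrow> D \<in> \<F>"
  by (simp add: maximal_cones_def)

text \<open>
  Otherwise the cone would lie in the hyperplane orthogonal to \<open>x - y\<close> and have empty interior.
\<close>

lemma inner_gens_injective:
  assumes D: "D \<in> maximal_cones" and eq: "\<And>i. i \<in> gens D \<Longrightarrow> g i \<bullet> x = g i \<bullet> y"
  shows "x = y"
proof (rule ccontr)
  assume "x \<noteq> y"
  have "D \<subseteq> {z. (x - y) \<bullet> z = 0}"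
  proof
    fix z assume "z \<in> D"
    then obtain c where "z = (\<Sum>i\<in>gens D. c i *\<^sub>R g i)"
      using fan_cone_eq [OF maximal_in_fan [OF D]] by (auto simp: convex_cone_hull_indexed)
    moreover have "(x - y) \<bullet> g i = 0" if "i \<in> gens D" for i
      using eq [OF that] by (simp add: inner_diff_left inner_diff_right inner_commute [of _ "g i"])
    ultimately show "z \<in> {z. (x - y) \<bullet> z = 0}"
      by (simp add: inner_sum_right)
  qed
  then have "interior D \<subseteq> interior {z. (x - y) \<bullet> z = 0}" by (rule interior_mono)
  with \<open>x \<noteq> y\<close> D show False by (simp add: maximal_cones_def)
qed

text \<open>
  Finitely many closed sets with empty interior can be removed from a cover by closed sets.
\<close>

lemma Union_maximal_cones: "\<Union>maximal_cones = UNIV"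
proof -
  have closed: "closed D" if "D \<in> \<F>" for D
  proof -
    have "polyhedral_cone D" using fan that by (simp add: fan_def)
    then show ?thesis unfolding polyhedral_cone_def using closed_convex_cone_hull by metis
  qed
  have "interior (\<Union>maximal_cones \<union> \<Union>\<E>) = interior (\<Union>maximal_cones)"
    if "finite \<E>" "\<E> \<subseteq> \<F> - maximal_cones" for \<E>
    using that
  proof (induction \<E> rule: finite_induct)
    case (insert E \<E>)
    have "closed (\<Union>maximal_cones \<union> \<Union>\<E>)"
      using closed insert.hyps insert.prems finite_fan
      by (intro closed_Un closed_Union) (auto simp: maximal_cones_def)
    moreover have "interior E = {}"
      using insert.prems by (auto simp: maximal_cones_def)
    ultimately have "interior ((\<Union>maximal_cones \<union> \<Union>\<E>) \<union> E) = interior (\<Union>maximal_cones \<union> \<Union>\<E>)"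
      by (rule interior_closed_Un_empty_interior)
    moreover have "\<Union>maximal_cones \<union> \<Union>(insert E \<E>) = (\<Union>maximal_cones \<union> \<Union>\<E>) \<union> E"
      by auto
    ultimately show ?case using insert by simp
  qed simp
  from this [of "\<F> - maximal_cones"]
  have "interior (\<Union>maximal_cones \<union> \<Union>(\<F> - maximal_cones)) = interior (\<Union>maximal_cones)"
    using finite_fan by blast
  moreover have "\<Union>maximal_cones \<union> \<Union>(\<F> - maximal_cones) = UNIV"
    using complete by blast
  ultimately have "interior (\<Union>maximal_cones) = UNIV"
    by simp
  then show ?thesis
    using interior_subset by blast
qed

text \<open>
  The sum of the generators lies in the relative interior of \<open>C\<close>; a full-dimensional cone that
  contains this point meets \<open>C\<close> in a face that contains each of its summands.
\<close>

lemma extends_to_maximal: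
  assumes C: "C \<in> \<F>"
  obtains D where "D \<in> maximal_cones" "gens C \<subseteq> gens D"
proof -
  define p where "p = (\<Sum>i\<in>gens C. 1 *\<^sub>R g i)"
  obtain D where D: "D \<in> maximal_cones" "p \<in> D" using Union_maximal_cones by blast
  have DF: "D \<in> \<F>" using D maximal_in_fan by blast
  have "p \<in> convex_cone hull (g ` gens C)"
    unfolding p_def by (rule sum_in_convex_cone_hull) auto
  then have "p \<in> C" using fan_cone_eq [OF C] by blast
  have "i \<in> gens D" if "i \<in> gens C" for i
  proof -
    have "1 *\<^sub>R g i \<in> C \<inter> D"
    proof (rule face_summand_sum [where f = "\<lambda>i. 1 *\<^sub>R g i" and I = "gens C"])
      show "convex_cone C" using C by (rule convex_cone_fan)
      show "C \<inter> D face_of C" using C DF by (rule Int_face)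
      show "(\<Sum>i\<in>gens C. 1 *\<^sub>R g i) \<in> C \<inter> D" using D \<open>p \<in> C\<close> by (simp add: p_def)
    qed (use that in \<open>auto simp: gens_def\<close>)
    then show ?thesis by (simp add: gens_def)
  qed
  then show ?thesis using that D by blast
qed

lemma maximal_cones_nonempty: "maximal_cones \<noteq> {}"
  using Union_maximal_cones by auto

section \<open>Normal fans and the inequalities of the type cone\<close>

definition vertices_strictly_feasible :: "real^'m \<Rightarrow> bool" where
  "vertices_strictly_feasible h \<longleftrightarrow>
     (\<forall>D\<in>maximal_cones. \<forall>v. (\<forall>i\<in>gens D. g i \<bullet> v = h $ i) \<longrightarrow> (\<forall>j. j \<notin> gens D \<longrightarrow> g j \<bullet> v < h $ j))"

text \<open>
  The set \<open>face_at h D\<close> is the face of \<open>P_of G h\<close> that should have normal cone \<open>D\<close>.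
\<close>

definition face_at :: "real^'m \<Rightarrow> (real^'n) set \<Rightarrow> (real^'n) set" where
  "face_at h D = {x \<in> P_of G h. \<forall>i\<in>gens D. g i \<bullet> x = h $ i}"

text \<open>
  Extend \<open>C\<close> to a full-dimensional cone \<open>D\<close> and start at its vertex. A small step in a direction that
  keeps the inequalities of \<open>C\<close> tight and relaxes the other inequalities of \<open>D\<close> preserves the strict
  ones. The resulting point lies in the relative interior of \<open>face_at h C\<close>.
\<close>

lemma exact_tight_point:
  assumes h: "vertices_strictly_feasible h" and C: "C \<in> \<F>"
  obtains x where "\<And>i. i \<in> gens C \<Longrightarrow> g i \<bullet> x = h $ i" "\<And>i. i \<notin> gens C \<Longrightarrow> g i \<bullet> x < h $ i"
proof -
  obtain D where D: "D \<in> maximal_cones" "gens C \<subseteq> gens D" by (rule extends_to_maximal [OF C])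
  have DF: "D \<in> \<F>" using D(1) by (rule maximal_in_fan)
  obtain v where v: "\<forall>i\<in>gens D. g i \<bullet> v = h $ i"
    using prescribed_on_gens [OF DF, of "\<lambda>i. h $ i"] by blast
  obtain w where w: "\<forall>i\<in>gens D. g i \<bullet> w = (if i \<in> gens C then 0 else -1)"
    using prescribed_on_gens [OF DF, of "\<lambda>i. if i \<in> gens C then 0 else -1"] by blast
  have "g j \<bullet> v < h $ j" if "j \<in> - gens D" for j
    using h D v that unfolding vertices_strictly_feasible_def by blast
  then have "\<exists>e>0. \<forall>j\<in>- gens D. g j \<bullet> v + e * (g j \<bullet> w) < h $ j"
    by (intro small_step_preserves_strict) auto
  then obtain e where e: "0 < e" "\<And>j. j \<notin> gens D \<Longrightarrow> g j \<bullet> v + e * (g j \<bullet> w) < h $ j"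
    by blast
  show ?thesis
  proof
    show "g i \<bullet> (v + e *\<^sub>R w) = h $ i" if "i \<in> gens C" for i
      using that v w D(2) by (auto simp: inner_add_right)
    show "g i \<bullet> (v + e *\<^sub>R w) < h $ i" if "i \<notin> gens C" for i
      using that v w e by (cases "i \<in> gens D") (auto simp: inner_add_right)
  qed
qed

text \<open>
  Weak duality with complementary slackness: the difference of the two sides is the sum of
  the nonnegative terms \<open>t i * (h $ i - g i \<bullet> y)\<close> with all \<open>t i\<close> positive.
\<close>

lemma positive_combination_bound:
  assumes c: "c = (\<Sum>i\<in>gens D. t i *\<^sub>R g i)" "\<And>i. i \<in> gens D \<Longrightarrow> 0 < t i" and y: "y \<in> P_of G h"
  shows "c \<bullet> y \<le> (\<Sum>i\<in>gens D. t i * h $ i)"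
    and "c \<bullet> y = (\<Sum>i\<in>gens D. t i * h $ i) \<longleftrightarrow> y \<in> face_at h D"
proof -
  have le: "0 \<le> t i * (h $ i - g i \<bullet> y)" if "i \<in> gens D" for i
    using c(2) [OF that] y by (simp add: mem_P_of)
  have eq: "(\<Sum>i\<in>gens D. t i * h $ i) - c \<bullet> y = (\<Sum>i\<in>gens D. t i * (h $ i - g i \<bullet> y))"
    by (simp add: c(1) inner_sum_left right_diff_distrib sum_subtractf)
  show "c \<bullet> y \<le> (\<Sum>i\<in>gens D. t i * h $ i)"
    using eq sum_nonneg [of "gens D" "\<lambda>i. t i * (h $ i - g i \<bullet> y)"] le by auto
  have "c \<bullet> y = (\<Sum>i\<in>gens D. t i * h $ i) \<longleftrightarrow> (\<Sum>i\<in>gens D. t i * (h $ i - g i \<bullet> y)) = 0"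
    using eq by auto
  also have "\<dots> \<longleftrightarrow> (\<forall>i\<in>gens D. t i * (h $ i - g i \<bullet> y) = 0)"
    using le by (intro sum_nonneg_eq_0_iff) auto
  also have "\<dots> \<longleftrightarrow> y \<in> face_at h D"
    using c(2) y by (force simp: face_at_def)
  finally show "c \<bullet> y = (\<Sum>i\<in>gens D. t i * h $ i) \<longleftrightarrow> y \<in> face_at h D" .
qed

lemma polytope_P_of: "polytope (P_of G h)"
proof -
  have "\<exists>M. \<forall>x\<in>P_of G h. c \<bullet> x \<le> M" for c
  proof -
    obtain D t where "D \<in> \<F>" "c = (\<Sum>i\<in>gens D. t i *\<^sub>R g i)" "\<And>i. i \<in> gens D \<Longrightarrow> 0 < t i"
      by (rule positive_carrier [of c]) (rule that)
    then show ?thesis using positive_combination_bound(1) by blast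
  qed
  then show ?thesis
    by (simp add: polytope_eq_bounded_polyhedron polyhedron_P_of bounded_if_bounded_above_in_directions)
qed

lemma face_at_face: "face_at h D face_of P_of G h"
proof -
  let ?c = "\<Sum>i\<in>gens D. 1 *\<^sub>R g i" and ?b = "\<Sum>i\<in>gens D. 1 * h $ i"
  have "(P_of G h \<inter> {x. ?c \<bullet> x = ?b}) face_of P_of G h"
    using positive_combination_bound(1) [OF refl, of D "\<lambda>_. 1"] polyhedron_imp_convex [OF polyhedron_P_of]
    by (intro face_of_Int_supporting_hyperplane_le) auto
  moreover have "P_of G h \<inter> {x. ?c \<bullet> x = ?b} = face_at h D"
    using positive_combination_bound(2) [OF refl, of D "\<lambda>_. 1"] by (auto simp: face_at_def)
  ultimately show ?thesis by simp
qed

text \<open>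
  The cone is contained in the normal cone because its generators are maximal where they are tight.
  Conversely, let \<open>z\<close> be a functional maximal on \<open>face_at h D\<close>, and write it as a positive combination of the
  generators of a cone \<open>E\<close>. At a point where exactly the inequalities of \<open>D\<close> are tight, maximality of
  \<open>z\<close> makes the inequalities of \<open>E\<close> tight, so the generators of \<open>E\<close> belong to \<open>D\<close>.
\<close>

lemma outer_normal_cone_face_at:
  assumes h: "vertices_strictly_feasible h" and D: "D \<in> \<F>"
  shows "outer_normal_cone (P_of G h) (face_at h D) = D"
proof
  show "D \<subseteq> outer_normal_cone (P_of G h) (face_at h D)"
  proof
    fix z assume "z \<in> D"
    then obtain c where c: "z = (\<Sum>i\<in>gens D. c i *\<^sub>R g i)" "\<forall>i\<in>gens D. 0 \<le> c i"
      using fan_cone_eq [OF D] by (auto simp: convex_cone_hull_indexed)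
    have "z \<bullet> y \<le> z \<bullet> x" if "x \<in> face_at h D" "y \<in> P_of G h" for x y
      using that c by (auto simp: face_at_def mem_P_of inner_sum_left intro!: sum_mono mult_left_mono)
    then show "z \<in> outer_normal_cone (P_of G h) (face_at h D)"
      by (simp add: outer_normal_cone_def)
  qed
next
  show "outer_normal_cone (P_of G h) (face_at h D) \<subseteq> D"
  proof
    fix z assume z: "z \<in> outer_normal_cone (P_of G h) (face_at h D)"
    obtain E t where E: "E \<in> \<F>" and t: "z = (\<Sum>i\<in>gens E. t i *\<^sub>R g i)" "\<And>i. i \<in> gens E \<Longrightarrow> 0 < t i"
      by (rule positive_carrier [of z]) (rule that)
    obtain q where q: "\<And>i. i \<in> gens D \<Longrightarrow> g i \<bullet> q = h $ i" "\<And>i. i \<notin> gens D \<Longrightarrow> g i \<bullet> q < h $ i"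
      by (rule exact_tight_point [OF h D]) (rule that)
    obtain e where e: "\<And>i. i \<in> gens E \<Longrightarrow> g i \<bullet> e = h $ i" "\<And>i. i \<notin> gens E \<Longrightarrow> g i \<bullet> e < h $ i"
      by (rule exact_tight_point [OF h E]) (rule that)
    have qP: "q \<in> P_of G h" and eP: "e \<in> P_of G h"
      unfolding mem_P_of by (metis q less_eq_real_def, metis e less_eq_real_def)
    have "q \<in> face_at h D" "e \<in> face_at h E" using q e qP eP by (auto simp: face_at_def)
    then have "z \<bullet> e \<le> z \<bullet> q" using z eP by (simp add: outer_normal_cone_def)
    moreover have "z \<bullet> e = (\<Sum>i\<in>gens E. t i * h $ i)"
      using positive_combination_bound(2) [OF t eP] \<open>e \<in> face_at h E\<close> by blast
    ultimately have "q \<in> face_at h E"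
      using positive_combination_bound [OF t qP] by auto
    then have "gens E \<subseteq> gens D" using q(2) by (force simp: face_at_def)
    then have "convex_cone hull (g ` gens E) \<subseteq> D" by (rule convex_cone_hull_gens_subset [OF D])
    moreover have "z \<in> convex_cone hull (g ` gens E)"
      unfolding t(1) using t(2) by (intro sum_in_convex_cone_hull) (simp add: less_imp_le)
    ultimately show "z \<in> D" by blast
  qed
qed

text \<open>
  Faces of polyhedra are exposed, and the exposing functional is a positive combination of the
  generators of a cone \<open>E\<close>; it attains its maximum exactly on \<open>face_at h E\<close>.
\<close>

lemma face_eq_face_at:
  assumes h: "vertices_strictly_feasible h" and Q: "Q face_of P_of G h" "Q \<noteq> {}"
  obtains E where "E \<in> \<F>" "Q = face_at h E"
proof -
  have "Q exposed_face_of P_of G h"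
    using Q(1) by (simp add: exposed_face_of_polyhedron polyhedron_P_of)
  then obtain a b where ab: "P_of G h \<subseteq> {x. a \<bullet> x \<le> b}" "Q = P_of G h \<inter> {x. a \<bullet> x = b}"
    by (auto simp: exposed_face_of_def)
  obtain E t where E: "E \<in> \<F>" and t: "a = (\<Sum>i\<in>gens E. t i *\<^sub>R g i)" "\<And>i. i \<in> gens E \<Longrightarrow> 0 < t i"
    by (rule positive_carrier [of a]) (rule that)
  obtain e where e: "\<And>i. i \<in> gens E \<Longrightarrow> g i \<bullet> e = h $ i" "\<And>i. i \<notin> gens E \<Longrightarrow> g i \<bullet> e < h $ i"
    by (rule exact_tight_point [OF h E]) (rule that)
  have eP: "e \<in> P_of G h" unfolding mem_P_of by (metis e less_eq_real_def)
  have "e \<in> face_at h E" using e eP by (auto simp: face_at_def)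
  then have ae: "a \<bullet> e = (\<Sum>i\<in>gens E. t i * h $ i)"
    using positive_combination_bound(2) [OF t eP] by blast
  obtain q where q: "q \<in> Q" using Q(2) by blast
  then have "b \<le> (\<Sum>i\<in>gens E. t i * h $ i)"
    using positive_combination_bound(1) [OF t, of q h] ab(2) by auto
  moreover have "a \<bullet> e \<le> b" using ab(1) eP by blast
  ultimately have "b = (\<Sum>i\<in>gens E. t i * h $ i)" using ae by simp
  then have "Q = face_at h E"
    unfolding ab(2) using positive_combination_bound(2) [OF t, of _ h] by (auto simp: face_at_def)
  with E show ?thesis using that by blast
qed

lemma vertices_strictly_feasible_imp_realization:
  assumes h: "vertices_strictly_feasible h"
  shows "polytopal_realization \<F> (P_of G h)"
proof -
  have "normal_fan (P_of G h) \<subseteq> \<F>"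
    using face_eq_face_at [OF h] outer_normal_cone_face_at [OF h]
    unfolding normal_fan_def by (smt (verit) mem_Collect_eq subsetI)
  moreover have "D \<in> normal_fan (P_of G h)" if D: "D \<in> \<F>" for D
  proof -
    obtain q where q: "\<And>i. i \<in> gens D \<Longrightarrow> g i \<bullet> q = h $ i" "\<And>i. i \<notin> gens D \<Longrightarrow> g i \<bullet> q < h $ i"
      by (rule exact_tight_point [OF h D]) (rule that)
    then have "q \<in> face_at h D" unfolding face_at_def mem_P_of by (auto, metis less_eq_real_def)
    then have "face_at h D \<noteq> {}" by blast
    then show ?thesis
      unfolding normal_fan_def using face_at_face outer_normal_cone_face_at [OF h D] by blast
  qed
  ultimately show ?thesis by (auto simp: polytopal_realization_def polytope_P_of)
qed

text \<open>
  Let \<open>Q\<close> be the face whose normal cone is the \<open>i\<close>-th ray. By duality \<open>g i\<close> is a nonnegative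
  combination of rows tight at a point of \<open>Q\<close>, and complementary slackness makes each row used in it
  tight on all of \<open>Q\<close>. Such a row lies in the normal cone of \<open>Q\<close>, which is a single ray, so it is
  \<open>g i\<close> itself.
\<close>

lemma ray_attains_bound:
  assumes h: "polytopal_realization \<F> (P_of G h)"
  shows "\<exists>x\<in>P_of G h. g i \<bullet> x = h $ i"
proof -
  have "convex_cone hull {g i} \<in> normal_fan (P_of G h)"
    using h ray_in_fan by (simp add: polytopal_realization_def)
  then obtain Q where Q: "Q face_of P_of G h" "Q \<noteq> {}"
    and K: "outer_normal_cone (P_of G h) Q = convex_cone hull {g i}"
    unfolding normal_fan_def by auto
  have QP: "Q \<subseteq> P_of G h" using Q(1) by (rule face_of_imp_subset)
  obtain x where x: "x \<in> Q" using Q(2) by blast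
  have xP: "x \<in> P_of G h" using x QP by blast
  have "g i \<in> outer_normal_cone (P_of G h) Q"
    unfolding K by (simp add: hull_inc)
  then have opt: "g i \<bullet> y \<le> g i \<bullet> z" if "y \<in> P_of G h" "z \<in> Q" for y z
    using that by (auto simp: outer_normal_cone_def)
  have "g i \<in> convex_cone hull (g ` {j. g j \<bullet> x = h $ j})"
    using xP opt x by (intro optimal_imp_in_tight_cone) (auto simp: mem_P_of)
  then obtain c where c: "g i = (\<Sum>j | g j \<bullet> x = h $ j. c j *\<^sub>R g j)" "\<forall>j\<in>{j. g j \<bullet> x = h $ j}. 0 \<le> c j"
    by (auto simp: convex_cone_hull_indexed)
  have "\<exists>j\<in>{j. g j \<bullet> x = h $ j}. c j \<noteq> 0"
  proof (rule ccontr)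
    assume "\<not> ?thesis"
    then have "(\<Sum>j | g j \<bullet> x = h $ j. c j *\<^sub>R g j) = 0"
      by (intro sum.neutral) auto
    with c(1) ray_nonzero [of i] show False by metis
  qed
  then obtain j where j: "g j \<bullet> x = h $ j" "c j \<noteq> 0" by blast
  have "g j \<bullet> y = h $ j" if y: "y \<in> Q" for y
  proof -
    have yP: "y \<in> P_of G h" using y QP by blast
    have "g i \<bullet> x = g i \<bullet> y" using opt xP yP x y by (simp add: order_antisym)
    then have "(\<Sum>k | g k \<bullet> x = h $ k. c k * (g k \<bullet> x)) = (\<Sum>k | g k \<bullet> x = h $ k. c k * (g k \<bullet> y))"
      unfolding c(1) by (simp add: inner_sum_left)
    then have "(\<Sum>k | g k \<bullet> x = h $ k. c k * (g k \<bullet> x - g k \<bullet> y)) = 0"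
      by (simp add: right_diff_distrib sum_subtractf)
    moreover have "0 \<le> c k * (g k \<bullet> x - g k \<bullet> y)" if "k \<in> {k. g k \<bullet> x = h $ k}" for k
      using that c(2) yP by (auto simp: mem_P_of)
    ultimately have "c j * (g j \<bullet> x - g j \<bullet> y) = 0"
      using j(1) by (subst (asm) sum_nonneg_eq_0_iff) auto
    with j show ?thesis by simp
  qed
  then have "g j \<in> outer_normal_cone (P_of G h) Q"
    by (auto simp: outer_normal_cone_def mem_P_of)
  then have "j = i" unfolding K by (rule ray_unique)
  with j xP show ?thesis by blast
qed

text \<open>
  On the face with normal cone \<open>D\<close> every generator of \<open>D\<close> attains its bound, so that
  this face is the single point \<open>v\<close>. A further row tight at \<open>v\<close> would belong to the normal cone \<open>D\<close>.
\<close>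

lemma realization_imp_vertices_strictly_feasible:
  assumes h: "polytopal_realization \<F> (P_of G h)"
  shows "vertices_strictly_feasible h"
  unfolding vertices_strictly_feasible_def
proof (intro ballI allI impI)
  fix D v j
  assume D: "D \<in> maximal_cones" and v: "\<forall>i\<in>gens D. g i \<bullet> v = h $ i" and j: "j \<notin> gens D"
  have "D \<in> normal_fan (P_of G h)"
    using h maximal_in_fan [OF D] by (simp add: polytopal_realization_def)
  then obtain Q where Q: "Q face_of P_of G h" "Q \<noteq> {}" and K: "outer_normal_cone (P_of G h) Q = D"
    unfolding normal_fan_def by auto
  have QP: "Q \<subseteq> P_of G h" using Q(1) by (rule face_of_imp_subset)
  have "q = v" if q: "q \<in> Q" for q
  proof (rule inner_gens_injective [OF D])
    fix i assume i: "i \<in> gens D"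
    then have "g i \<in> outer_normal_cone (P_of G h) Q" by (simp add: K gens_def)
    moreover obtain x where "x \<in> P_of G h" "g i \<bullet> x = h $ i" using ray_attains_bound [OF h] by blast
    ultimately have "h $ i \<le> g i \<bullet> q" using q unfolding outer_normal_cone_def by fastforce
    moreover have "g i \<bullet> q \<le> h $ i" using q QP by (auto simp: mem_P_of)
    ultimately show "g i \<bullet> q = g i \<bullet> v" using v i by simp
  qed
  then have Qv: "Q = {v}" using Q(2) by blast
  have "g j \<notin> outer_normal_cone (P_of G h) {v}" using j K Qv by (simp add: gens_def)
  then have "g j \<bullet> v \<noteq> h $ j" by (auto simp: outer_normal_cone_def mem_P_of)
  moreover have "g j \<bullet> v \<le> h $ j" using QP Qv by (auto simp: mem_P_of)
  ultimately show "g j \<bullet> v < h $ j" by simp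
qed

lemma type_cone_eq: "type_cone \<F> G = {h. vertices_strictly_feasible h}"
  using vertices_strictly_feasible_imp_realization realization_imp_vertices_strictly_feasible
  by (auto simp: type_cone_def)

text \<open>
  With \<open>w i\<close> the basis dual to the generators of \<open>D\<close>, the vertex is \<open>v = (\<Sum>i\<in>gens D. h $ i *\<^sub>R w i)\<close>,
  which is linear in \<open>h\<close>.
\<close>

lemma vertex_slack_functional:
  assumes D: "D \<in> maximal_cones"
  shows "\<exists>a :: 'm \<Rightarrow> real^'m. \<forall>h v. (\<forall>i\<in>gens D. g i \<bullet> v = h $ i) \<longrightarrow> (\<forall>j. a j \<bullet> h = h $ j - g j \<bullet> v)"
proof -
  have "\<exists>w. \<forall>k\<in>gens D. g k \<bullet> w = (if k = i then 1 else 0)" for i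
    using prescribed_on_gens [OF maximal_in_fan [OF D], of "\<lambda>k. if k = i then 1 else 0"] by simp
  then obtain w where w: "\<And>i k. k \<in> gens D \<Longrightarrow> g k \<bullet> w i = (if k = i then 1 else 0)"
    by metis
  define a where "a j = axis j 1 - (\<Sum>i\<in>gens D. (g j \<bullet> w i) *\<^sub>R axis i (1::real))" for j
  have "a j \<bullet> h = h $ j - g j \<bullet> v" if v: "\<forall>i\<in>gens D. g i \<bullet> v = h $ i" for h v j
  proof -
    have "v = (\<Sum>i\<in>gens D. h $ i *\<^sub>R w i)"
    proof (rule inner_gens_injective [OF D])
      fix k assume k: "k \<in> gens D"
      have "g k \<bullet> (\<Sum>i\<in>gens D. h $ i *\<^sub>R w i) = (\<Sum>i\<in>gens D. if k = i then h $ i else 0)"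
        by (simp add: inner_sum_right w [OF k] if_distrib cong: if_cong)
      then show "g k \<bullet> v = g k \<bullet> (\<Sum>i\<in>gens D. h $ i *\<^sub>R w i)"
        using v k by simp
    qed
    then show ?thesis
      by (simp add: a_def inner_diff_left inner_sum_left inner_sum_right inner_axis' mult.commute)
  qed
  then show ?thesis by blast
qed

text \<open>
  The members of \<open>A\<close> are the slacks of the remaining inequalities at the vertices. If all of them vanish on \<open>z\<close>, then
  any one vertex \<open>v\<close> for the right-hand side \<open>z\<close> already satisfies \<open>G v = z\<close>.
\<close>

lemma type_cone_open_halfspaces:
  obtains A where "finite A" "type_cone \<F> G = {h. \<forall>a\<in>A. 0 < a \<bullet> h}"
    "\<And>z. (\<forall>a\<in>A. a \<bullet> z = 0) \<longleftrightarrow> z \<in> range ((*v) G)"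
proof -
  obtain a :: "(real^'n) set \<Rightarrow> 'm \<Rightarrow> real^'m" where a:
    "\<And>D h v j. D \<in> maximal_cones \<Longrightarrow> (\<forall>i\<in>gens D. g i \<bullet> v = h $ i) \<Longrightarrow> a D j \<bullet> h = h $ j - g j \<bullet> v"
    using vertex_slack_functional by metis
  have vertex: "\<exists>v. \<forall>i\<in>gens D. g i \<bullet> v = h $ i" if "D \<in> maximal_cones" for D h
    using prescribed_on_gens [OF maximal_in_fan [OF that], of "\<lambda>i. h $ i"] by simp
  define A where "A = {a D j | D j. D \<in> maximal_cones \<and> j \<notin> gens D}"
  show ?thesis
  proof (rule that)
    have "A \<subseteq> case_prod a ` (\<F> \<times> UNIV)"
      by (auto simp: A_def maximal_cones_def)
    then show "finite A"
      by (rule finite_subset) (simp add: finite_fan)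
    have "vertices_strictly_feasible h \<longleftrightarrow> (\<forall>b\<in>A. 0 < b \<bullet> h)" for h
    proof
      assume h: "vertices_strictly_feasible h"
      show "\<forall>b\<in>A. 0 < b \<bullet> h"
      proof
        fix b assume "b \<in> A"
        then obtain D j where Dj: "b = a D j" "D \<in> maximal_cones" "j \<notin> gens D" by (auto simp: A_def)
        obtain v where v: "\<forall>i\<in>gens D. g i \<bullet> v = h $ i" using vertex [OF Dj(2)] by blast
        then have "g j \<bullet> v < h $ j" using h Dj unfolding vertices_strictly_feasible_def by blast
        then show "0 < b \<bullet> h" using a [OF Dj(2) v] Dj(1) by simp
      qed
    next
      assume h: "\<forall>b\<in>A. 0 < b \<bullet> h"
      show "vertices_strictly_feasible h"
        unfolding vertices_strictly_feasible_def
      proof (intro ballI allI impI)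
        fix D v j
        assume D: "D \<in> maximal_cones" and v: "\<forall>i\<in>gens D. g i \<bullet> v = h $ i" and j: "j \<notin> gens D"
        have "a D j \<in> A" using D j by (auto simp: A_def)
        then have "0 < a D j \<bullet> h" using h by blast
        then show "g j \<bullet> v < h $ j" using a [OF D v] by simp
      qed
    qed
    then show "type_cone \<F> G = {h. \<forall>a\<in>A. 0 < a \<bullet> h}"
      by (simp add: type_cone_eq)
    fix z
    note Gv = mult_vec_nth_eq_inner_row [of G]
    show "(\<forall>b\<in>A. b \<bullet> z = 0) \<longleftrightarrow> z \<in> range ((*v) G)"
    proof
      assume z: "\<forall>b\<in>A. b \<bullet> z = 0"
      obtain D where D: "D \<in> maximal_cones" using maximal_cones_nonempty by blast
      obtain v where v: "\<forall>i\<in>gens D. g i \<bullet> v = z $ i" using vertex [OF D] by blast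
      have "g j \<bullet> v = z $ j" for j
      proof (cases "j \<in> gens D")
        case False
        then have "a D j \<in> A" using D by (auto simp: A_def)
        then have "a D j \<bullet> z = 0" using z by blast
        then show ?thesis using a [OF D v] by simp
      qed (use v in simp)
      then have "z = G *v v" by (simp add: vec_eq_iff Gv)
      then show "z \<in> range ((*v) G)" by blast
    next
      assume "z \<in> range ((*v) G)"
      then obtain x where x: "z = G *v x" by blast
      show "\<forall>b\<in>A. b \<bullet> z = 0"
      proof
        fix b assume "b \<in> A"
        then obtain D j where Dj: "b = a D j" "D \<in> maximal_cones" by (auto simp: A_def)
        show "b \<bullet> z = 0"
          using a [OF Dj(2), of x z j] by (simp add: x Gv Dj(1))
      qed
    qed
  qed
qed

end

section \<open>Facet normals of open polyhedral cones\<close>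

lemma interior_Int_halfspaces:
  fixes A :: "'a::euclidean_space set"
  assumes "finite A" "0 \<notin> A"
  shows "interior {h. \<forall>a\<in>A. 0 \<le> a \<bullet> h} = {h. \<forall>a\<in>A. 0 < a \<bullet> h}"
  using assms
proof (induction A rule: finite_induct)
  case (insert a A)
  have "{h. \<forall>b\<in>insert a A. 0 \<le> b \<bullet> h} = {h. a \<bullet> h \<ge> 0} \<inter> {h. \<forall>b\<in>A. 0 \<le> b \<bullet> h}"
    by auto
  with insert show ?case by auto
qed simp

lemma closure_open_halfspaces:
  fixes A :: "'a::euclidean_space set"
  assumes "finite A" "{h. \<forall>a\<in>A. 0 < a \<bullet> h} \<noteq> {}"
  shows "closure {h. \<forall>a\<in>A. 0 < a \<bullet> h} = {h. \<forall>a\<in>A. 0 \<le> a \<bullet> h}" (is "closure ?U = ?C")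
    and "interior {h. \<forall>a\<in>A. 0 \<le> a \<bullet> h} = {h. \<forall>a\<in>A. 0 < a \<bullet> h}"
    and "polyhedron {h. \<forall>a\<in>A. 0 \<le> a \<bullet> h}"
proof -
  have C: "?C = \<Inter>((\<lambda>a. {h. a \<bullet> h \<ge> 0}) ` A)" by auto
  show poly: "polyhedron ?C"
    unfolding C using assms(1) by (intro polyhedron_Inter) (auto simp: polyhedron_halfspace_ge)
  have "0 \<notin> A" using assms(2) by force
  with assms(1) show int: "interior ?C = ?U" by (rule interior_Int_halfspaces)
  have "closure (interior ?C) = closure ?C"
    using poly assms(2) int by (intro convex_closure_interior) (auto simp: polyhedron_imp_convex)
  then show "closure ?U = ?C"
    using int poly by (simp add: polyhedron_imp_closed)
qed

text \<open>
  A normal of a supporting hyperplane is positive on the interior. Conversely, consider a segment from an interior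
  point to a point outside \<open>C\<close>. It meets the boundary, hence a facet, at some \<open>p\<close>, where the normal of that facet
  vanishes. If all normals were positive at both ends of the segment, they would be positive at \<open>p\<close>.
\<close>

lemma facet_normals_describe_interior:
  fixes C :: "'a::euclidean_space set"
  assumes C: "polyhedron C" and ne: "interior C \<noteq> {}"
    and \<phi>: "\<And>\<Phi>. \<Phi> facet_of C \<Longrightarrow> \<exists>i. \<Phi> = \<phi> i" and k: "\<And>i. inner_normal C (\<phi> i) (k i)"
    and fin: "finite (range k)"
  shows "interior C = {h. \<forall>i. 0 < k i \<bullet> h}"
proof
  have int_pos: "0 < k i \<bullet> h" if h: "h \<in> interior C" for h i
  proof -
    have "C \<subseteq> {h. k i \<bullet> h \<ge> 0}" "k i \<noteq> 0" using k [of i] by (auto simp: inner_normal_def)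
    then have "interior C \<subseteq> {h. k i \<bullet> h > 0}" using interior_mono [of C "{h. k i \<bullet> h \<ge> 0}"] by simp
    with h show ?thesis by blast
  qed
  then show "interior C \<subseteq> {h. \<forall>i. 0 < k i \<bullet> h}" by blast
  obtain h0 where h0: "h0 \<in> interior C" using ne by blast
  have "h \<in> C" if h: "\<forall>i. 0 < k i \<bullet> h" for h
  proof (rule ccontr)
    assume "h \<notin> C"
    have "closed_segment h0 h \<inter> C \<noteq> {}" using h0 interior_subset by auto
    moreover have "closed_segment h0 h - C \<noteq> {}" using \<open>h \<notin> C\<close> by auto
    ultimately obtain p where p: "p \<in> closed_segment h0 h" "p \<in> frontier C"
      using connected_Int_frontier [OF connected_segment(1)] by blast
    have "p \<in> C - rel_interior C"
      using p(2) ne C by (simp add: frontier_def rel_interior_nonempty_interior polyhedron_imp_closed)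
    then obtain \<Phi> where "\<Phi> facet_of C" "p \<in> \<Phi>"
      using rel_boundary_of_polyhedron [OF C] by blast
    then obtain i where i: "p \<in> \<phi> i" using \<phi> by metis
    then have "k i \<bullet> p = 0" using k [of i] by (auto simp: inner_normal_def)
    moreover have "0 < k i \<bullet> p"
    proof -
      obtain u where u: "0 \<le> u" "u \<le> 1" "p = (1 - u) *\<^sub>R h0 + u *\<^sub>R h"
        using p(1) by (auto simp: in_segment)
      have "0 < k i \<bullet> h0" "0 < k i \<bullet> h" using int_pos [OF h0] h by auto
      then show ?thesis
        unfolding u(3) using u(1,2)
        by (cases "u = 0") (auto simp: inner_add_right intro!: add_nonneg_pos)
    qed
    ultimately show False by simp
  qed
  then have "{h. \<forall>i. 0 < k i \<bullet> h} \<subseteq> C" by blast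
  moreover have "open {h. \<forall>i. 0 < k i \<bullet> h}"
  proof -
    have "{h. \<forall>i. 0 < k i \<bullet> h} = \<Inter>((\<lambda>b. {h. 0 < b \<bullet> h}) ` range k)" by auto
    moreover have "open \<dots>"
      using fin by (intro open_Inter) (auto intro: open_halfspace_gt simp: open_halfspace_gt)
    ultimately show ?thesis by simp
  qed
  ultimately show "{h. \<forall>i. 0 < k i \<bullet> h} \<subseteq> interior C" by (rule interior_maximal)
qed

section \<open>Slack realizations\<close>

text \<open>
  The kernel has dimension at most \<open>n\<close>, so its orthogonal complement has dimension at
  least \<open>N - n\<close>, and \<open>K\<close> is injective there.
\<close>

lemma surj_matrix_if_kernel_small:
  fixes K :: "real^'m^'k" and G :: "real^'n^'m"
  assumes card: "CARD('k) + CARD('n) = CARD('m)"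
    and ker: "\<And>z. K *v z = 0 \<Longrightarrow> z \<in> range ((*v) G)"
  shows "surj ((*v) K)"
proof -
  let ?N = "{z. K *v z = 0}" and ?M = "{y. \<forall>x\<in>{z. K *v z = 0}. orthogonal x y}"
  have N: "subspace ?N"
    by (auto simp: subspace_def matrix_vector_right_distrib matrix_vector_mult_scaleR)
  have "dim ?N \<le> dim (range ((*v) G))" using ker by (intro dim_subset) auto
  also have "\<dots> \<le> dim (UNIV :: (real^'n) set)" by (rule dim_image_le) simp
  finally have "dim ?N \<le> CARD('n)" by simp
  moreover have "dim ?M + dim ?N = CARD('m)"
    using dim_subspace_orthogonal_to_vectors [OF N subspace_UNIV] by simp
  ultimately have "CARD('k) \<le> dim ?M" using card by linarith
  also have "dim ?M = dim ((*v) K ` ?M)"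
  proof (rule dim_image_eq [symmetric])
    have "subspace ?M" by (rule subspace_orthogonal_to_vectors)
    then have "span ?M = ?M" by simp
    moreover have "inj_on ((*v) K) ?M"
    proof (rule inj_onI)
      fix x y assume xy: "x \<in> ?M" "y \<in> ?M" "K *v x = K *v y"
      then have "x - y \<in> ?N" by (simp add: matrix_vector_mult_diff_distrib)
      moreover have "x - y \<in> ?M" by (rule subspace_diff [OF \<open>subspace ?M\<close> xy(1,2)])
      ultimately have "orthogonal (x - y) (x - y)" by blast
      then show "x = y" by (simp add: orthogonal_self)
    qed
    ultimately show "inj_on ((*v) K) (span ?M)" by (simp only:)
  qed simp
  also have "\<dots> \<le> dim (range ((*v) K))" by (intro dim_subset) auto
  finally have "dim (range ((*v) K)) = DIM(real^'k)"
    using dim_subset_UNIV [of "range ((*v) K)"] by simp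
  then have "span (range ((*v) K)) = UNIV" by (simp only: dim_eq_full)
  moreover have "subspace (range ((*v) K))" by (intro linear_subspace_image) auto
  ultimately show ?thesis by (metis span_eq_iff)
qed

theorem corollary1p11:
  fixes \<F> :: "(real^'n) set set"
    and G :: "real^'n^'m"
    and K :: "real^'m^'k"
  assumes "essential_fan \<F>" and "complete_fan \<F>" and "simplicial_fan \<F>"
    and "ray_matrix \<F> G"
    and "simplicial_type_cone \<F> G"
    and "CARD('k) + CARD('n) = CARD('m)"
    and "facet_normal_matrix \<F> G K"
  shows "(\<forall>l::real^'k. (\<forall>i. 0 < l $ i) \<longrightarrow> slack_realization \<F> G (R_of K l)) \<and>
         (\<forall>h\<in>type_cone \<F> G. \<exists>l::real^'k. (\<forall>i. 0 < l $ i) \<and> slack_image G h = R_of K l)"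
proof -
  interpret simplicial_complete_fan \<F> G
    using assms by unfold_locales (auto simp: complete_fan_def simplicial_fan_def)
  obtain A where finA: "finite A" and TC: "type_cone \<F> G = {h. \<forall>a\<in>A. 0 < a \<bullet> h}"
    and kerA: "\<And>z. (\<forall>a\<in>A. a \<bullet> z = 0) \<longleftrightarrow> z \<in> range ((*v) G)"
    by (rule type_cone_open_halfspaces) (rule that)
  have ne: "type_cone \<F> G \<noteq> {}" using assms(5) by (simp add: simplicial_type_cone_def)
  note halfspaces = closure_open_halfspaces [OF finA ne [unfolded TC], folded TC]
  obtain \<phi> where \<phi>: "bij_betw \<phi> UNIV (type_cone_facets \<F> G)"
    and nrm: "\<And>i. inner_normal (closure (type_cone \<F> G)) (\<phi> i) (row i K)"
    using assms(7) unfolding facet_normal_matrix_def by blast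
  have "interior (closure (type_cone \<F> G)) = {h. \<forall>i. 0 < row i K \<bullet> h}"
  proof (rule facet_normals_describe_interior [OF _ _ _ nrm])
    show "polyhedron (closure (type_cone \<F> G))" "interior (closure (type_cone \<F> G)) \<noteq> {}"
      using halfspaces ne by auto
    show "\<exists>i. \<Phi> = \<phi> i" if "\<Phi> facet_of closure (type_cone \<F> G)" for \<Phi>
      using that \<phi> by (auto simp: type_cone_facets_def bij_betw_def)
  qed simp
  then have "type_cone \<F> G = {h. \<forall>i. 0 < row i K \<bullet> h}" using halfspaces by simp
  then have TCK: "type_cone \<F> G = {h. \<forall>i. 0 < (K *v h) $ i}" by (simp add: mult_vec_nth_eq_inner_row)
  obtain h0 where h0: "h0 \<in> type_cone \<F> G" using ne by blast
  \<comment> \<open>Both \<open>K z = 0\<close> and \<open>z \<in> G \<real>\<^sup>n\<close> say that the line \<open>h0 + t z\<close> stays in the type cone, since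
    an affine function of \<open>t\<close> that is positive everywhere is constant.\<close>
  have scal: "c = 0" if "\<And>t. 0 < b + t * c" for b c :: real
    using that [of "- b / c"] by (cases "c = 0") auto
  have ker: "K *v z = 0 \<longleftrightarrow> z \<in> range ((*v) G)" for z
  proof -
    have "K *v z = 0 \<longleftrightarrow> (\<forall>t. h0 + t *\<^sub>R z \<in> type_cone \<F> G)"
    proof
      assume "K *v z = 0"
      then show "\<forall>t. h0 + t *\<^sub>R z \<in> type_cone \<F> G"
        using h0 by (simp add: TCK matrix_vector_right_distrib matrix_vector_mult_scaleR)
    next
      assume "\<forall>t. h0 + t *\<^sub>R z \<in> type_cone \<F> G"
      then have "0 < (K *v h0) $ i + t * (K *v z) $ i" for t i
        by (simp add: TCK matrix_vector_right_distrib matrix_vector_mult_scaleR)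
      then have "(K *v z) $ i = 0" for i by (rule scal)
      then show "K *v z = 0" by (simp add: vec_eq_iff)
    qed
    also have "\<dots> \<longleftrightarrow> (\<forall>a\<in>A. a \<bullet> z = 0)"
    proof
      assume "\<forall>t. h0 + t *\<^sub>R z \<in> type_cone \<F> G"
      then have "0 < a \<bullet> h0 + t * (a \<bullet> z)" if "a \<in> A" for t a
        using that by (simp add: TC inner_add_right)
      then show "\<forall>a\<in>A. a \<bullet> z = 0" using scal by blast
    next
      assume "\<forall>a\<in>A. a \<bullet> z = 0"
      then show "\<forall>t. h0 + t *\<^sub>R z \<in> type_cone \<F> G"
        using h0 by (simp add: TC inner_add_right)
    qed
    also have "\<dots> \<longleftrightarrow> z \<in> range ((*v) G)" by (rule kerA)
    finally show ?thesis .
  qed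
  have slack: "slack_image G h = R_of K (K *v h)" for h
  proof (intro antisym subsetI)
    fix z assume "z \<in> slack_image G h"
    then obtain x where x: "G *v x \<le> h" "z = h - G *v x" by (auto simp: slack_image_def P_of_def)
    have "K *v (G *v x) = 0" using ker by blast
    with x show "z \<in> R_of K (K *v h)"
      by (simp add: R_of_def matrix_vector_mult_diff_distrib less_eq_vec_def)
  next
    fix z assume z: "z \<in> R_of K (K *v h)"
    then have "K *v (h - z) = 0" by (simp add: R_of_def matrix_vector_mult_diff_distrib)
    then obtain x where x: "h - z = G *v x" using ker by blast
    then have zx: "z = h - G *v x" by (simp add: algebra_simps)
    have "G *v x \<le> h" using z unfolding zx by (simp add: R_of_def less_eq_vec_def)
    then show "z \<in> slack_image G h" using zx by (auto simp: slack_image_def P_of_def)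
  qed
  have "slack_realization \<F> G (R_of K l)" if l: "\<forall>i. 0 < l $ i" for l
  proof -
    have "surj ((*v) K)" using surj_matrix_if_kernel_small [OF assms(6)] ker by blast
    then obtain h where h: "l = K *v h" by (meson surjD)
    then have "h \<in> type_cone \<F> G" using l by (simp add: TCK)
    then have real: "polytopal_realization \<F> (P_of G h)" by (simp add: type_cone_def)
    have "slack_image G h = (+) h ` (\<lambda>x. - (G *v x)) ` P_of G h"
      by (auto simp: slack_image_def image_image)
    moreover have "linear (\<lambda>x. - (G *v x))" by (intro linear_compose_neg) simp
    ultimately have "polytope (slack_image G h)"
      by (simp add: polytope_translation_eq polytope_linear_image polytope_P_of)
    with real show ?thesis
      unfolding slack_realization_def h slack [symmetric] by blast
  qed
  moreover have "\<exists>l::real^'k. (\<forall>i. 0 < l $ i) \<and> slack_image G h = R_of K l" if "h \<in> type_cone \<F> G" for h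
    using that slack TCK by blast
  ultimately show ?thesis by blast
qed

end
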